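(* For every sequence $(d_n)_{n\in\mathbb{N}}$ of positive integers there exists a sequence $(A_n)_{n\in\mathbb{N}}$ of complex square matrices with spectra in the open unit disc $\mathbb{D}$, with $A_n$ of size $d_n\times d_n$, which is strongly separated, i.e. \[ \inf_{z\in\mathbb{D}}\ \sup_{n\in\mathbb{N}}\ \prod_{k\neq n}|B_{A_k}(z)|>0 . \]
   Context: For $\tau\in\mathbb{D}$, $b_\tau(z)=\frac{\tau-z}{1-\overline{\tau}z}$. The order of an eigenvalue $\lambda$ of a square matrix $M$ is the maximal size of the Jordan blocks of $M$ associated with $\lambda$. If $M$ has distinct eigenvalues $\lambda_1,\dots,\lambda_k\in\mathbb{D}$ with orders $m_1,\dots,m_k$, then $B_M(z)=\prod_{j=1}^k b_{\lambda_j}(z)^{m_j}$. Infinite products of numbers in $[0,1]$ are limits of the (decreasing) partial products. *)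

theory Defs
  imports
    "HOL-Analysis.Analysis"
    "Jordan_Normal_Form.Spectral_Radius"
    "Jordan_Normal_Form.Jordan_Normal_Form_Uniqueness"
begin

definition blaschke_factor :: "complex \<Rightarrow> complex \<Rightarrow> complex" where
  "blaschke_factor \<tau> z = (\<tau> - z) / (1 - cnj \<tau> * z)"

text \<open>The maximum ranges over all Jordan normal forms of \<open>M\<close>; they all contain the same blocks,
  see \<open>jordan_order_eq\<close>. For \<open>a\<close> outside the spectrum of \<open>M\<close> the value is meaningless.\<close>

definition jordan_order :: "complex mat \<Rightarrow> complex \<Rightarrow> nat" where
  "jordan_order M a = Max {m. \<exists>n_as. jordan_nf M n_as \<and> (m, a) \<in> set n_as}"

definition blaschke_mat :: "complex mat \<Rightarrow> complex \<Rightarrow> complex" where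
  "blaschke_mat M z = (\<Prod>a\<in>spectrum M. blaschke_factor a z ^ jordan_order M a)"

text \<open>The infinite product over \<open>k \<noteq> n\<close> is the limit of its partial products and may be \<open>0\<close>,
  so \<open>prodinf\<close> (which requires a nonzero limit) does not apply. For spectra and \<open>z\<close> in the unit
  disc the limit exists and lies in \<open>[0, 1]\<close>, see \<open>blaschke_prod_except_LIMSEQ\<close> and
  \<open>blaschke_prod_except_bounds\<close>.\<close>

definition blaschke_prod_except :: "(nat \<Rightarrow> complex mat) \<Rightarrow> nat \<Rightarrow> complex \<Rightarrow> real" where
  "blaschke_prod_except A n z = lim (\<lambda>N. \<Prod>k\<in>{..<N} - {n}. norm (blaschke_mat (A k) z))"

definition strongly_separated :: "(nat \<Rightarrow> complex mat) \<Rightarrow> bool" where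
  "strongly_separated A \<longleftrightarrow> (INF z\<in>ball 0 1. SUP n. blaschke_prod_except A n z) > 0"

lemma jordan_order_eq:
  assumes "jordan_nf M n_as"
  shows "jordan_order M a = Max {m. (m, a) \<in> set n_as}"
proof -
  have "set m_bs = set n_as" if "jordan_nf M m_bs" for m_bs
    using jordan_nf_unique[OF that assms] by simp
  then have "{m. \<exists>m_bs. jordan_nf M m_bs \<and> (m, a) \<in> set m_bs} = {m. (m, a) \<in> set n_as}"
    using assms by blast
  then show ?thesis
    by (simp add: jordan_order_def)
qed

lemma norm_blaschke_factor_le_1:
  assumes "norm \<tau> < 1" "norm z < 1"
  shows "norm (blaschke_factor \<tau> z) \<le> 1"
proof -
  have "0 \<le> (1 - (norm \<tau>)\<^sup>2) * (1 - (norm z)\<^sup>2)"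
    using assms by (intro mult_nonneg_nonneg) (auto simp: power_le_one)
  also have "\<dots> = (norm (1 - cnj \<tau> * z))\<^sup>2 - (norm (\<tau> - z))\<^sup>2"
    unfolding cmod_power2 by (simp add: algebra_simps power2_eq_square)
  finally have "norm (\<tau> - z) \<le> norm (1 - cnj \<tau> * z)"
    by (simp add: abs_le_square_iff[symmetric])
  then show ?thesis
    unfolding blaschke_factor_def norm_divide by (simp add: divide_le_eq_1)
qed

lemma norm_blaschke_mat_le_1:
  assumes "spectrum M \<subseteq> ball 0 1" "z \<in> ball 0 1"
  shows "norm (blaschke_mat M z) \<le> 1"
  unfolding blaschke_mat_def prod_norm[symmetric] norm_power
  using assms by (intro prod_le_1 conjI power_le_one norm_blaschke_factor_le_1) auto

lemma decseq_blaschke_partial_prods: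
  assumes "\<And>k. spectrum (A k) \<subseteq> ball 0 1" "z \<in> ball 0 1"
  shows "decseq (\<lambda>N. \<Prod>k\<in>{..<N} - {n}. norm (blaschke_mat (A k) z))"
proof (rule decseq_SucI)
  fix N
  let ?f = "\<lambda>k. norm (blaschke_mat (A k) z)"
  show "prod ?f ({..<Suc N} - {n}) \<le> prod ?f ({..<N} - {n})"
  proof (cases "N = n")
    case True
    then have "{..<Suc N} - {n} = {..<N} - {n}"
      by auto
    then show ?thesis
      by simp
  next
    case False
    then have "{..<Suc N} - {n} = insert N ({..<N} - {n})"
      by auto
    then have "prod ?f ({..<Suc N} - {n}) = ?f N * prod ?f ({..<N} - {n})"
      by simp
    also have "\<dots> \<le> prod ?f ({..<N} - {n})"
      by (intro mult_left_le_one_le prod_nonneg norm_blaschke_mat_le_1[OF assms] norm_ge_zero ballI)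
    finally show ?thesis .
  qed
qed

lemma blaschke_prod_except_LIMSEQ:
  assumes "\<And>k. spectrum (A k) \<subseteq> ball 0 1" "z \<in> ball 0 1"
  shows "(\<lambda>N. \<Prod>k\<in>{..<N} - {n}. norm (blaschke_mat (A k) z))
    \<longlonglongrightarrow> blaschke_prod_except A n z"
proof -
  obtain L where "(\<lambda>N. \<Prod>k\<in>{..<N} - {n}. norm (blaschke_mat (A k) z)) \<longlonglongrightarrow> L"
    by (rule decseq_convergent[OF decseq_blaschke_partial_prods[where n = n, OF assms], of 0])
      (auto intro!: prod_nonneg)
  then show ?thesis
    unfolding blaschke_prod_except_def by (simp add: limI)
qed

lemma blaschke_prod_except_bounds:
  assumes "\<And>k. spectrum (A k) \<subseteq> ball 0 1" "z \<in> ball 0 1"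
  shows "blaschke_prod_except A n z \<in> {0..1}"
proof -
  have "0 \<le> blaschke_prod_except A n z"
    by (rule LIMSEQ_le_const[OF blaschke_prod_except_LIMSEQ[OF assms]])
      (auto intro!: prod_nonneg)
  moreover have "blaschke_prod_except A n z \<le> 1"
    by (rule LIMSEQ_le_const2[OF blaschke_prod_except_LIMSEQ[OF assms]])
      (auto intro!: prod_le_1 norm_blaschke_mat_le_1[OF assms])
  ultimately show ?thesis
    by simp
qed

end

(* Diagonalizable matrices of any size with the single eigenvalue a have Blaschke factor b_a, so the
   sizes d n play no role, and it suffices to find a strongly separated sequence of points of the disc.
   Take a_k = 1 - e_k with e_k = 100^(-k-1). For t = |1 - z| one has
   |b_{a_k}(z)| >= |t - e_k| / (t + e_k). If n is chosen such that e_n is comparable to t, then for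
   k \<noteq> n the numbers t and e_k differ by a factor of at least 100 ^ |k - n| / 10, which bounds the
   factors with k \<noteq> n from below by 1 - 20 / 100 ^ |k - n|, uniformly in z. *)

theory Submission
  imports Defs
begin

lemma jordan_nf_jordan_matrix:
  assumes "0 \<notin> fst ` set n_as"
  shows "jordan_nf (jordan_matrix n_as) n_as"
  using assms similar_mat_refl[OF jordan_matrix_carrier] by (simp add: jordan_nf_def)

text \<open>All Jordan blocks have size 1, so the order of \<open>a\<close> is 1 although its
  algebraic multiplicity is \<open>m\<close>. For \<open>m = 0\<close> the spectrum would be
  empty.\<close>

lemma blaschke_mat_jordan_matrix_replicate:
  fixes a :: complex
  assumes "m > 0"
  defines "M \<equiv> jordan_matrix (replicate m (1, a))"
  shows "M \<in> carrier_mat m m" "spectrum M = {a}" "blaschke_mat M z = blaschke_factor a z"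
proof -
  show M: "M \<in> carrier_mat m m"
    unfolding M_def using jordan_matrix_carrier[of "replicate m (1, a)"]
    by (simp add: sum_list_replicate)
  have "char_poly M = [:- a, 1:] ^ m"
    unfolding M_def jordan_matrix_char_poly by simp
  then show spec: "spectrum M = {a}"
    using spectrum_root_char_poly[OF M] assms(1) by (auto simp: poly_power)
  have "jordan_nf M (replicate m (1, a))"
    unfolding M_def by (rule jordan_nf_jordan_matrix) auto
  then have "jordan_order M a = Max {k. (k, a) \<in> set (replicate m (1, a))}"
    by (rule jordan_order_eq)
  also have "{k. (k, a) \<in> set (replicate m (1, a))} = {1}"
    using assms(1) by auto
  finally show "blaschke_mat M z = blaschke_factor a z"
    by (simp add: blaschke_mat_def spec)
qed

text \<open>With w = 1 - z the numerator is w - e and the denominator is (1 - e) w + e. The reverse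
  triangle inequality bounds the first from below, the triangle inequality the second from
  above.\<close>

lemma norm_blaschke_factor_of_real_ge:
  assumes "0 < e" "e < 1" "norm z < 1"
  shows "norm (blaschke_factor (of_real (1 - e)) z)
    \<ge> \<bar>norm (1 - z) - e\<bar> / (norm (1 - z) + e)"
proof -
  let ?a = "complex_of_real (1 - e)" and ?t = "norm (1 - z)"
  have "\<bar>?t - e\<bar> \<le> norm ((1 - z) - of_real e)"
    using norm_triangle_ineq3[of "1 - z" "of_real e"] assms by simp
  then have num: "\<bar>?t - e\<bar> \<le> norm (?a - z)"
    by (simp add: algebra_simps)
  have "norm (cnj ?a * z) < 1"
    using assms mult_strict_mono'[of "1 - e" 1 "norm z" 1] by (simp add: norm_mult del: of_real_diff)
  then have "1 - cnj ?a * z \<noteq> 0"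
    by (metis eq_iff_diff_eq_0 norm_one order_less_irrefl)
  then have pos: "norm (1 - cnj ?a * z) > 0"
    by simp
  have "1 - cnj ?a * z = of_real (1 - e) * (1 - z) + of_real e"
    by (simp add: algebra_simps)
  then have "norm (1 - cnj ?a * z) \<le> norm (of_real (1 - e) * (1 - z)) + norm (complex_of_real e)"
    by (metis norm_triangle_ineq)
  also have "\<dots> = (1 - e) * ?t + e"
    using assms by (simp add: norm_mult del: of_real_diff)
  also have "\<dots> \<le> ?t + e"
    using assms by (simp add: mult_left_le_one_le)
  finally show ?thesis
    unfolding blaschke_factor_def norm_divide using num pos by (intro frac_le) auto
qed

text \<open>If e \<le> x t, the quotient is at least 1 - 2 e / (t + e) \<ge> 1 - 2 e / t. The other
  case is symmetric.\<close>

lemma abs_diff_over_sum_ge: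
  fixes t e x :: real
  assumes "t > 0" "e > 0" "e \<le> x * t \<or> t \<le> x * e"
  shows "1 - 2 * x \<le> \<bar>t - e\<bar> / (t + e)"
proof -
  have "x > 0"
    using assms by (smt (verit) mult_nonneg_nonneg mult_nonpos_nonneg)
  then have "x * t > 0" "x * e > 0"
    using assms by auto
  then have "(1 - 2 * x) * (t + e) \<le> \<bar>t - e\<bar>"
    using assms(3) by (auto simp: algebra_simps abs_if)
  then show ?thesis
    using assms by (simp add: pos_le_divide_eq)
qed

lemma sum_power_dist_le:
  fixes n N :: nat
  shows "(\<Sum>k\<in>{..<N} - {n}. (1 / 100 :: real) ^ ((n - k) + (k - n))) \<le> 2 / 99"
proof -
  let ?f = "\<lambda>k. (1 / 100 :: real) ^ ((n - k) + (k - n))"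
  \<comment> \<open>The bound 1/99 is the fixed point of the recursion s \<mapsto> (s + 1) / 100,
    which these sums satisfy.\<close>
  have "(\<Sum>k<n. (1 / 100 :: real) ^ (n - k)) \<le> 1 / 99" for n
  proof (induction n)
    case (Suc n)
    have "(\<Sum>k<n. (1 / 100 :: real) ^ (Suc n - k)) = 1 / 100 * (\<Sum>k<n. (1 / 100) ^ (n - k))"
      unfolding sum_distrib_left by (intro sum.cong) (auto simp: Suc_diff_le)
    with Suc show ?case
      by simp
  qed simp
  then have below: "sum ?f {..<n} \<le> 1 / 99"
    by (smt (verit, best) add.right_neutral diff_is_0_eq' lessThan_iff less_imp_le sum.cong)
  \<comment> \<open>Here the induction appends the smallest term, so the bound 1/99 alone would not
    propagate; the closed form does.\<close>
  have "(\<Sum>k\<in>{n<..n + m}. (1 / 100 :: real) ^ (k - n)) = (1 - (1 / 100) ^ m) / 99" for m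
  proof (induction m)
    case (Suc m)
    have "{n<..n + Suc m} = insert (n + Suc m) {n<..n + m}"
      by auto
    with Suc have "(\<Sum>k\<in>{n<..n + Suc m}. (1 / 100 :: real) ^ (k - n)) =
        (1 / 100) ^ Suc m + (1 - (1 / 100) ^ m) / 99"
      by simp
    also have "\<dots> = (1 - (1 / 100) ^ Suc m) / 99"
      by (simp add: field_simps)
    finally show ?case .
  qed simp
  moreover have "sum ?f {n<..n + N} = (\<Sum>k\<in>{n<..n + N}. (1 / 100) ^ (k - n))"
    by (intro sum.cong) auto
  ultimately have above: "sum ?f {n<..n + N} \<le> 1 / 99"
    by simp
  have "sum ?f ({..<N} - {n}) \<le> sum ?f ({..<n} \<union> {n<..n + N})"
    by (intro sum_mono2) auto
  also have "\<dots> = sum ?f {..<n} + sum ?f {n<..n + N}"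
    by (intro sum.union_disjoint) auto
  finally show ?thesis
    using below above by simp
qed

lemma ex_geometric_scale:
  fixes t :: real
  assumes "t > 0"
  obtains n where "\<And>k. k \<noteq> n \<Longrightarrow>
    1 - 20 * (1 / 100) ^ ((n - k) + (k - n)) \<le> \<bar>t - (1 / 100) ^ Suc k\<bar> / (t + (1 / 100) ^ Suc k)"
proof
  let ?e = "\<lambda>k. (1 / 100 :: real) ^ Suc k"
  \<comment> \<open>Minimality gives e_n \<le> 10 t and, if n > 0, also 10 t < e_(n-1) = 100 e_n.
    Thus t and e_n differ by a factor of at most 10, the square root of the ratio 100. For n = 0 the
    second bound is missing, but then no k < n exists.\<close>
  define n where "n = (LEAST n. ?e n \<le> 10 * t)"
  have "\<exists>n. (1 / 100) ^ n < t"
    using assms by (intro real_arch_pow_inv) auto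
  then obtain m where "(1 / 100) ^ m < t" ..
  then have "?e m \<le> 10 * t"
    using assms by simp
  then have n: "?e n \<le> 10 * t"
    unfolding n_def by (rule LeastI)
  fix k
  assume "k \<noteq> n"
  then consider "n < k" | "k < n"
    by linarith
  then have "?e k \<le> (10 * (1 / 100) ^ ((n - k) + (k - n))) * t \<or>
    t \<le> (10 * (1 / 100) ^ ((n - k) + (k - n))) * ?e k"
  proof cases
    case 1
    then have "?e k = (1 / 100) ^ (k - n) * ?e n"
      by (simp flip: power_add)
    also have "\<dots> \<le> (1 / 100) ^ (k - n) * (10 * t)"
      using n by (intro mult_left_mono) auto
    finally show ?thesis
      using 1 by (simp add: mult_ac)
  next
    case 2
    then obtain p where p: "n = Suc p" "k \<le> p"
      by (cases n) auto
    then have "\<not> ?e p \<le> 10 * t"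
      unfolding n_def by (metis lessI n_def not_less_Least)
    moreover have "?e p = (1 / 100) ^ (p - k) * ?e k"
      using p by (simp flip: power_add)
    ultimately have "t \<le> (1 / 10) * ((1 / 100) ^ (p - k) * ?e k)"
      by linarith
    \<comment> \<open>Since n - k = (p - k) + 1, one factor 1/100 turns 10 into 1/10.\<close>
    also have "\<dots> = 10 * (1 / 100) ^ ((n - k) + (k - n)) * ?e k"
      using p by (simp add: Suc_diff_le)
    finally show ?thesis ..
  qed
  then have "1 - 2 * (10 * (1 / 100) ^ ((n - k) + (k - n))) \<le> \<bar>t - ?e k\<bar> / (t + ?e k)"
    using assms by (intro abs_diff_over_sum_ge) auto
  then show "1 - 20 * (1 / 100) ^ ((n - k) + (k - n)) \<le> \<bar>t - ?e k\<bar> / (t + ?e k)"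
    by simp
qed

theorem mainTheorem3:
  fixes d :: "nat \<Rightarrow> nat"
  assumes "\<And>n. d n > 0"
  shows "\<exists>A :: nat \<Rightarrow> complex mat.
    (\<forall>n. A n \<in> carrier_mat (d n) (d n)) \<and>
    (\<forall>n. spectrum (A n) \<subseteq> ball 0 1) \<and>
    strongly_separated A"
proof -
  define e :: "nat \<Rightarrow> real" where "e k = (1 / 100) ^ Suc k" for k
  have e: "0 < e k" "e k < 1" for k
    unfolding e_def by (simp, rule power_Suc_less_one) simp_all
  define A where "A k = jordan_matrix (replicate (d k) (1, complex_of_real (1 - e k)))" for k
  have A: "A k \<in> carrier_mat (d k) (d k)" "spectrum (A k) = {complex_of_real (1 - e k)}"
    "blaschke_mat (A k) z = blaschke_factor (complex_of_real (1 - e k)) z" for k z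
    unfolding A_def by (rule blaschke_mat_jordan_matrix_replicate[OF assms])+
  have spec: "spectrum (A k) \<subseteq> ball 0 1" for k
    using e[of k] by (simp add: A(2) del: of_real_diff)
  \<comment> \<open>The constant is 1 - 20 * (2 / 99). The index \<open>n\<close> found below
    depends on \<open>z\<close>, but this bound does not.\<close>
  have "59 / 99 \<le> (SUP n. blaschke_prod_except A n z)" if z: "z \<in> ball 0 1" for z
  proof -
    have "norm (1 - z) > 0"
      using z by auto
    then obtain n where n: "\<And>k. k \<noteq> n \<Longrightarrow> 1 - 20 * (1 / 100) ^ ((n - k) + (k - n))
        \<le> \<bar>norm (1 - z) - e k\<bar> / (norm (1 - z) + e k)"
      unfolding e_def using ex_geometric_scale by blast
    have "59 / 99 \<le> (\<Prod>k\<in>{..<N} - {n}. norm (blaschke_mat (A k) z))" for N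
    proof -
      let ?x = "\<lambda>k. 20 * (1 / 100 :: real) ^ ((n - k) + (k - n))"
      \<comment> \<open>For k \<noteq> n the exponent is at least 1, so \<open>?x k\<close> is at
        most 20/100. The Weierstrass inequality below needs values in [0, 1].\<close>
      have x: "?x k \<in> {0..1}" if "k \<noteq> n" for k
      proof -
        have "(1 / 100 :: real) ^ ((n - k) + (k - n)) \<le> (1 / 100) ^ 1"
          using that by (intro power_decreasing) auto
        then show ?thesis
          by simp
      qed
      have "59 / 99 \<le> 1 - sum ?x ({..<N} - {n})"
        using sum_power_dist_le[of n N] by (simp flip: sum_distrib_left)
      also have "\<dots> \<le> (\<Prod>k\<in>{..<N} - {n}. 1 - ?x k)"
        using x by (intro Weierstrass_prod_ineq) auto
      also have "\<dots> \<le> (\<Prod>k\<in>{..<N} - {n}. norm (blaschke_mat (A k) z))"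
      proof (intro prod_mono conjI)
        fix k
        assume "k \<in> {..<N} - {n}"
        then show "0 \<le> 1 - ?x k" "1 - ?x k \<le> norm (blaschke_mat (A k) z)"
          using x[of k] n[of k] norm_blaschke_factor_of_real_ge[OF e, of z k] z
          by (auto simp: A(3) simp del: of_real_diff)
      qed
      finally show ?thesis .
    qed
    then have "59 / 99 \<le> blaschke_prod_except A n z"
      by (intro LIMSEQ_le_const[OF blaschke_prod_except_LIMSEQ[OF spec z]]) auto
    also have "\<dots> \<le> (SUP n. blaschke_prod_except A n z)"
      using blaschke_prod_except_bounds[OF spec z]
      by (intro cSUP_upper bdd_aboveI2[where M = 1]) auto
    finally show ?thesis .
  qed
  then have "59 / 99 \<le> (INF z\<in>ball 0 1. SUP n. blaschke_prod_except A n z)"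
    by (intro cINF_greatest) auto
  then have "strongly_separated A"
    unfolding strongly_separated_def by simp
  with A(1) spec show ?thesis
    by blast
qed

end
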